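(* Let $D\ge5$ be a prime power. Then there exist two-site unitary operators $A,B,C$ on $\mathbb{C}^D\otimes\mathbb{C}^D$, each of which is a perfect tensor, such that for every unit vector $|v\rangle\in\mathbb{C}^D$ and every two-site unitary operator $\mathcal{K}$ on $\mathbb{C}^D\otimes\mathbb{C}^D$ with $\mathcal{K}(|v\rangle\otimes|v\rangle)=\frac{1}{\sqrt D}\sum_{a}|a\rangle\otimes|a\rangle$, the state $$|\Psi\rangle=C^{(23)}B^{(13)}A^{(12)}\mathcal{K}^{(14)}\mathcal{K}^{(25)}\mathcal{K}^{(36)}\,|v\rangle^{\otimes 6}\in(\mathbb{C}^D)^{\otimes6}$$ is absolutely maximally entangled. In particular, some absolutely maximally entangled state of six parties of local dimension $D$ can be created from a product of three Bell pairs with three two-site unitaries, and from a product state with six two-site unitaries.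
   Context: $\{|a\rangle\}$ denotes a fixed computational orthonormal basis of $\mathbb{C}^D$. For a two-site operator $X$, $X^{(ij)}$ denotes the operator on the multi-site tensor product acting as $X$ on sites $i,j$ (in this order) and as the identity elsewhere. A pure state of $k$ sites (each with Hilbert space $\mathbb{C}^D$) is maximally entangled for a bipartition $P\cup Q$ of the sites with $|P|\le|Q|$ if its reduced density matrix on $P$ equals $D^{-|P|}$ times the identity; it is absolutely maximally entangled (AME) if it is maximally entangled for all bipartitions with $|P|=\lfloor k/2\rfloor$. A two-site operator $X$ with matrix elements $X_{a_1a_2}^{b_1b_2}=\langle b_1b_2|X|a_1a_2\rangle$ is a perfect tensor if the four-site state $\frac1D\sum X_{a_1a_2}^{b_1b_2}|a_1,a_2,b_1,b_2\rangle$ is AME. *)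

theory Defs
  imports
    "HOL-Analysis.Analysis"
    "HOL-Library.Numeral_Type"
    "HOL-Number_Theory.Prime_Powers"
begin

text \<open>
  \<open>complex ^ 'd\<close> is the local space with \<open>D = CARD('d)\<close>; the computational basis vectors are
  \<open>axis a 1\<close>. A system with sites \<open>'s\<close> lives in \<open>complex ^ ('s \<Rightarrow> 'd)\<close>, whose coordinates are
  indexed by assignments of a basis label to every site. An operator \<open>X\<close> is the matrix with
  \<open>X $ b $ a = \<langle>b|X|a\<rangle>\<close>.

  Sites are elements of the numeral types \<open>4\<close> and \<open>6\<close>. These are residues, so the last site, written
  \<open>4\<close> resp. \<open>6\<close>, is the element \<open>0\<close>; the numerals \<open>1, \<dots>, 6 :: 6\<close> are pairwise distinct and exhaust
  the type (and likewise for \<open>4\<close>).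
\<close>

type_synonym 'd two_site_state = "complex ^ ('d \<times> 'd)"
type_synonym 'd two_site_op = "complex ^ ('d \<times> 'd) ^ ('d \<times> 'd)"
type_synonym ('s, 'd) state = "complex ^ ('s \<Rightarrow> 'd)"
type_synonym ('s, 'd) operator = "complex ^ ('s \<Rightarrow> 'd) ^ ('s \<Rightarrow> 'd)"

definition conj_transpose :: "complex ^ 'n ^ 'm \<Rightarrow> complex ^ 'm ^ 'n"
  where "conj_transpose A = (\<chi> i j. cnj (A $ j $ i))"

definition unitary :: "complex ^ 'n ^ 'n \<Rightarrow> bool"
  where "unitary U \<longleftrightarrow> conj_transpose U ** U = mat 1 \<and> U ** conj_transpose U = mat 1"

definition tensor :: "complex ^ 'd \<Rightarrow> complex ^ 'd \<Rightarrow> 'd two_site_state"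
  where "tensor v w = (\<chi> p. v $ fst p * w $ snd p)"

definition tensor_all :: "('s \<Rightarrow> complex ^ 'd) \<Rightarrow> ('s::finite, 'd::finite) state"
  where "tensor_all v = (\<chi> f. \<Prod>i\<in>UNIV. v i $ f i)"

definition bell :: "'d::finite two_site_state"
  where "bell = (1 / sqrt (real CARD('d))) *\<^sub>R (\<Sum>a\<in>UNIV. tensor (axis a 1) (axis a 1))"

text \<open>The operator \<open>X\<^sup>(\<^sup>i\<^sup>j\<^sup>)\<close>; only meaningful for \<open>i \<noteq> j\<close>.\<close>

definition on_sites :: "'d two_site_op \<Rightarrow> 's \<Rightarrow> 's \<Rightarrow> ('s::finite, 'd::finite) operator"
  where "on_sites X i j =
    (\<chi> g f. if \<forall>s. s \<noteq> i \<and> s \<noteq> j \<longrightarrow> g s = f s then X $ (g i, g j) $ (f i, f j) else 0)"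

text \<open>
  Entry \<open>\<langle>x| Tr\<^sub>Q |\<psi>\<rangle>\<langle>\<psi>| |y\<rangle>\<close> of the reduced density matrix on \<open>P\<close>, with \<open>Q = - P\<close>;
  \<open>override_on z x P\<close> is the assignment that is \<open>x\<close> on \<open>P\<close> and \<open>z\<close> on \<open>Q\<close>.
\<close>

definition reduced_density ::
    "('s::finite, 'd::finite) state \<Rightarrow> 's set \<Rightarrow> ('s \<Rightarrow> 'd) \<Rightarrow> ('s \<Rightarrow> 'd) \<Rightarrow> complex"
  where "reduced_density \<psi> P x y =
    (\<Sum>z \<in> - P \<rightarrow>\<^sub>E UNIV. \<psi> $ override_on z x P * cnj (\<psi> $ override_on z y P))"

definition maximally_entangled :: "('s::finite, 'd::finite) state \<Rightarrow> 's set \<Rightarrow> bool"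
  where "maximally_entangled \<psi> P \<longleftrightarrow>
    (\<forall>x \<in> P \<rightarrow>\<^sub>E UNIV. \<forall>y \<in> P \<rightarrow>\<^sub>E UNIV.
      reduced_density \<psi> P x y = (if x = y then 1 / of_nat (CARD('d) ^ card P) else 0))"

definition absolutely_maximally_entangled :: "('s::finite, 'd::finite) state \<Rightarrow> bool"
  where "absolutely_maximally_entangled \<psi> \<longleftrightarrow>
    norm \<psi> = 1 \<and> (\<forall>P. card P = CARD('s) div 2 \<longrightarrow> maximally_entangled \<psi> P)"

text \<open>Sites \<open>1, 2, 3, 4\<close> carry the labels \<open>a\<^sub>1, a\<^sub>2, b\<^sub>1, b\<^sub>2\<close>.\<close>

definition perfect_tensor :: "'d::finite two_site_op \<Rightarrow> bool"
  where "perfect_tensor X \<longleftrightarrow>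
    absolutely_maximally_entangled
      ((\<chi> f. X $ (f 3, f 4) $ (f 1, f 2) / of_nat CARD('d)) :: (4, 'd) state)"

definition three_bell_pairs :: "(6, 'd::finite) state \<Rightarrow> bool"
  where "three_bell_pairs \<phi> \<longleftrightarrow>
    (\<exists>i\<^sub>1 j\<^sub>1 i\<^sub>2 j\<^sub>2 i\<^sub>3 j\<^sub>3. distinct [i\<^sub>1, j\<^sub>1, i\<^sub>2, j\<^sub>2, i\<^sub>3, j\<^sub>3] \<and>
      \<phi> = (\<chi> f. bell $ (f i\<^sub>1, f j\<^sub>1) * bell $ (f i\<^sub>2, f j\<^sub>2) * bell $ (f i\<^sub>3, f j\<^sub>3)))"

definition product_state :: "('s::finite, 'd::finite) state \<Rightarrow> bool"
  where "product_state \<phi> \<longleftrightarrow> (\<exists>v. (\<forall>i. norm (v i) = 1) \<and> \<phi> = tensor_all v)"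

definition created_from ::
    "nat \<Rightarrow> ('s::finite, 'd::finite) state \<Rightarrow> ('s, 'd) state \<Rightarrow> bool"
  where "created_from n \<phi> \<psi> \<longleftrightarrow>
    (\<exists>gates :: ('d two_site_op \<times> 's \<times> 's) list. length gates = n \<and>
      (\<forall>(U, i, j) \<in> set gates. unitary U \<and> i \<noteq> j) \<and>
      \<psi> = fold (\<lambda>(U, i, j) x. on_sites U i j *v x) gates \<phi>)"

end

theory Submission
  imports
    Defs
    "HOL-Algebra.Algebraic_Closure_Type"
    "Berlekamp_Zassenhaus.Finite_Field"
begin

text \<open>
  Label the basis by the field \<open>F\<close> with \<open>D\<close> elements and let the gates permute basis vectors by
  invertible linear maps of \<open>F\<^sup>2\<close>. The final state is then the uniform superposition of the words of
  a linear code of length 6 and dimension 3, and it is absolutely maximally entangled iff any three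
  letters determine a word. A word consists, up to nonzero factors, of the leading coefficient of a
  polynomial \<open>N\<close> of degree at most 2 and the values of \<open>N\<close> at five distinct points
  \<open>0, x, y\<^sub>1, y\<^sub>2, y\<^sub>3\<close>, so three zero letters force \<open>N = 0\<close>. The encoding matrix factors into three
  two-site maps, all of whose entries and determinants are nonzero iff
  \<open>y\<^sub>1 y\<^sub>2 + y\<^sub>3 x - y\<^sub>3 (y\<^sub>1 + y\<^sub>2) \<noteq> 0\<close>. This can be arranged when \<open>D \<ge> 5\<close>: among four nonzero elements
  choose \<open>y\<^sub>1 + y\<^sub>2 \<noteq> 0\<close>; the expression changes by \<open>(y\<^sub>3 - x) (y\<^sub>1 + y\<^sub>2)\<close> when \<open>x\<close> and \<open>y\<^sub>3\<close> are swapped.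
\<close>

hide_const (open) Divisibility.prime up_ring.monom

section \<open>The finite field with \<open>D\<close> elements as a type\<close>

text \<open>Over an algebraically closed field \<open>X^q - X\<close> splits into q linear factors.
  They are distinct because the derivative \<open>q X^(q-1) - 1\<close> is the constant -1 in this
  characteristic.\<close>

lemma card_Frobenius_fixed:
  assumes "prime CHAR('a::alg_closed_field)" and q: "q = CHAR('a) ^ k" and "k > 0"
  shows "card {x :: 'a. x ^ q = x} = q"
proof -
  define f :: "'a poly" where "f = monom 1 q - monom 1 1"
  have "1 < q"
    using assms prime_gt_1_nat by (metis one_less_power)
  then have deg: "Polynomial.degree f = q"
    unfolding f_def diff_conv_add_uminus by (subst degree_add_eq_left) (auto simp: Polynomial.degree_monom_eq)
  have root_iff: "poly f x = 0 \<longleftrightarrow> x ^ q = x" for x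
    by (simp add: f_def poly_monom)
  have "(of_nat q :: 'a) = 0"
    using \<open>k > 0\<close> by (simp add: q of_nat_eq_0_iff_char_dvd)
  then have pderiv_f: "pderiv f = - 1"
    by (simp add: f_def pderiv_diff pderiv_monom monom_0 flip: one_pCons)
  have "f \<noteq> 0"
    using deg \<open>1 < q\<close> by auto
  obtain R where R: "size R = q" "f = Polynomial.smult (Polynomial.lead_coeff f) (\<Prod>x\<in>#R. [:- x, 1:])"
    using alg_closed_imp_factorization[OF \<open>f \<noteq> 0\<close>] deg by auto
  have "count R x \<le> 1" for x
  proof (rule ccontr)
    assume "\<not> count R x \<le> 1"
    then have "{#x, x#} \<subseteq># R"
      by (auto simp: subseteq_mset_def)
    then obtain S where "R = {#x, x#} + S"
      by (auto simp: mset_subset_eq_exists_conv)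
    \<comment> \<open>A repeated root divides \<open>f\<close> twice and is therefore a root of the
      derivative as well.\<close>
    with R(2) obtain g where "f = [:- x, 1:] * ([:- x, 1:] * g)"
      by (metis (no_types, lifting) image_mset_add_mset mult_smult_right prod_mset.add_mset
          union_mset_add_mset_left union_mset_def add_mset_add_single)
    then have "poly (pderiv f) x = 0"
      by (simp only: pderiv_mult poly_add poly_mult) simp
    with pderiv_f show False
      by simp
  qed
  then have "card (set_mset R) = size R"
    by (metis (no_types, lifting) count_greater_zero_iff One_nat_def card_eq_sum le_antisym less_eq_Suc_le
        size_multiset_overloaded_eq sum.cong)
  moreover have "set_mset R = {x. poly f x = 0}"
    using \<open>f \<noteq> 0\<close> by (subst R(2)) (auto simp: poly_prod_mset prod_mset_zero_iff)
  ultimately show ?thesis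
    using R(1) by (simp add: root_iff)
qed

text \<open>
  The value 2 for a cardinality that is not a prime power is arbitrary; it makes \<open>'d gf\<close>
  a field for every finite type \<open>'d\<close>.
\<close>

definition gf_order :: "'d::finite itself \<Rightarrow> nat"
  where "gf_order _ = (if primepow CARD('d) then CARD('d) else 2)"

lemma primepow_gf_order: "primepow (gf_order TYPE('d::finite))"
  by (auto simp: gf_order_def intro: primepow_prime)

lemma one_less_gf_order: "1 < gf_order TYPE('d::finite)"
  using primepow_gt_Suc_0[OF primepow_gf_order] by simp

text \<open>\<open>mod_ring\<close> reads its modulus off the cardinality of its argument, so the
  prime field is named through a type with p elements, p being the prime divisor of the
  order.\<close>

typedef ('d::finite) gf_index = "{..<aprimedivisor (gf_order TYPE('d))}"
  using aprimedivisor_pos_nat[OF one_less_gf_order[where 'd='d]] by blast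

lemma CARD_gf_index: "CARD('d gf_index) = aprimedivisor (gf_order TYPE('d::finite))"
  using type_definition.card[OF type_definition_gf_index[where 'd='d]] by simp

lemma prime_CARD_gf_index: "prime CARD('d::finite gf_index)"
  using one_less_gf_order[where 'd='d] by (simp add: CARD_gf_index prime_aprimedivisor')

instance gf_index :: (finite) prime_card
  by standard (rule prime_CARD_gf_index)

lemma gf_order_eq_CHAR_power:
  "\<exists>k>0. gf_order TYPE('d::finite) = CHAR('d gf_index mod_ring alg_closure) ^ k"
proof -
  obtain p k where pk: "prime p" "k > 0" "gf_order TYPE('d) = p ^ k"
    using primepow_gf_order by (auto simp: primepow_def)
  then have "CHAR('d gf_index mod_ring alg_closure) = p"
    by (simp add: CARD_gf_index aprimedivisor_prime_power)
  with pk show ?thesis by auto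
qed

text \<open>The subfield of order q in the algebraic closure of the prime field, as the fixed points
  of an iterate of the Frobenius map.\<close>

typedef (overloaded) ('d::finite) gf = "{x :: 'd gf_index mod_ring alg_closure. x ^ gf_order TYPE('d) = x}"
proof
  show "0 \<in> {x :: 'd gf_index mod_ring alg_closure. x ^ gf_order TYPE('d) = x}"
    using one_less_gf_order[where 'd='d] by (simp add: power_0_left)
qed

setup_lifting type_definition_gf

lemma prime_CHAR_gf: "prime CHAR('d::finite gf_index mod_ring alg_closure)"
  by (simp add: prime_CARD_gf_index)

lemma gf_power_add:
  fixes x y :: "'d::finite gf_index mod_ring alg_closure"
  shows "(x + y) ^ gf_order TYPE('d) = x ^ gf_order TYPE('d) + y ^ gf_order TYPE('d)"
  using gf_order_eq_CHAR_power[where 'd='d] freshmans_dream'[OF prime_CHAR_gf] by blast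

text \<open>Additivity applied to \<open>x + (- x) = 0\<close> treats odd and even orders
  alike.\<close>

lemma gf_power_minus:
  fixes x :: "'d::finite gf_index mod_ring alg_closure"
  shows "(- x) ^ gf_order TYPE('d) = - (x ^ gf_order TYPE('d))"
proof -
  have "x ^ gf_order TYPE('d) + (- x) ^ gf_order TYPE('d) = 0"
    using gf_power_add[of x "- x"] one_less_gf_order[where 'd='d] by (simp add: power_0_left)
  then show ?thesis
    by (simp add: add_eq_0_iff)
qed

instantiation gf :: (finite) field
begin

lift_definition zero_gf :: "'a gf" is 0
  using one_less_gf_order[where 'd='a] by (simp add: power_0_left)

lift_definition one_gf :: "'a gf" is 1
  by simp

lift_definition plus_gf :: "'a gf \<Rightarrow> 'a gf \<Rightarrow> 'a gf" is "(+)"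
  by (simp add: gf_power_add)

lift_definition uminus_gf :: "'a gf \<Rightarrow> 'a gf" is uminus
  by (simp add: gf_power_minus)

lift_definition minus_gf :: "'a gf \<Rightarrow> 'a gf \<Rightarrow> 'a gf" is "(-)"
  by (simp only: diff_conv_add_uminus gf_power_add gf_power_minus)

lift_definition times_gf :: "'a gf \<Rightarrow> 'a gf \<Rightarrow> 'a gf" is "(*)"
  by (simp add: power_mult_distrib)

lift_definition inverse_gf :: "'a gf \<Rightarrow> 'a gf" is inverse
  by (simp add: power_inverse)

lift_definition divide_gf :: "'a gf \<Rightarrow> 'a gf \<Rightarrow> 'a gf" is "(/)"
  by (simp add: power_divide)

instance
  by standard (transfer; simp add: algebra_simps divide_inverse)+

end

lemma CARD_gf_eq_order: "CARD('d::finite gf) = gf_order TYPE('d)"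
proof -
  obtain k where "k > 0" "gf_order TYPE('d) = CHAR('d gf_index mod_ring alg_closure) ^ k"
    using gf_order_eq_CHAR_power by blast
  then have "card {x :: 'd gf_index mod_ring alg_closure. x ^ gf_order TYPE('d) = x} = gf_order TYPE('d)"
    by (intro card_Frobenius_fixed prime_CHAR_gf)
  then show ?thesis
    using type_definition.card[OF type_definition_gf[where 'd='d]] by simp
qed

lemma CARD_gf: "primepow CARD('d::finite) \<Longrightarrow> CARD('d gf) = CARD('d)"
  by (simp add: CARD_gf_eq_order gf_order_def)

text \<open>An infinite type would have cardinality 0, whereas the cardinality here is the order,
  which exceeds 1.\<close>

instance gf :: (finite) finite
  by standard (use one_less_gf_order[where 'd='a] in \<open>simp add: card_ge_0_finite CARD_gf_eq_order\<close>)

section \<open>Uniform superpositions and permutation gates\<close>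

text \<open>The amplitude is a parameter because it is 1/D for the four-site state of a gate and
  \<open>D^(-3/2)\<close> for the six-site state.\<close>

definition uniform_state :: "complex \<Rightarrow> ('s \<Rightarrow> 'd) set \<Rightarrow> ('s::finite, 'd::finite) state"
  where "uniform_state \<alpha> S = (\<chi> f. if f \<in> S then \<alpha> else 0)"

definition perm_op :: "('d \<times> 'd \<Rightarrow> 'd \<times> 'd) \<Rightarrow> 'd::finite two_site_op"
  where "perm_op \<pi> = (\<chi> b a. if b = \<pi> a then 1 else 0)"

definition gate_map :: "('d \<times> 'd \<Rightarrow> 'd \<times> 'd) \<Rightarrow> 's \<Rightarrow> 's \<Rightarrow> ('s \<Rightarrow> 'd) \<Rightarrow> 's \<Rightarrow> 'd"
  where "gate_map \<pi> i j f = f(i := fst (\<pi> (f i, f j)), j := snd (\<pi> (f i, f j)))"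

lemma unitary_perm_op:
  assumes "bij \<pi>"
  shows "unitary (perm_op \<pi>)"
proof -
  have "(\<Sum>k\<in>UNIV. cnj (if k = \<pi> i then 1 else 0) * (if k = \<pi> j then 1 else 0)) = (if i = j then 1 else (0::complex))" for i j
  proof -
    have "(\<Sum>k\<in>UNIV. cnj (if k = \<pi> i then 1 else 0) * (if k = \<pi> j then 1 else 0)) =
        (\<Sum>k\<in>UNIV. if k = \<pi> i then (if i = j then 1 else 0) else (0::complex))"
      using assms by (intro sum.cong) (auto simp: bij_def inj_eq)
    then show ?thesis by simp
  qed
  moreover have "(\<Sum>k\<in>UNIV. (if i = \<pi> k then 1 else 0) * cnj (if j = \<pi> k then 1 else 0)) = (if i = j then 1 else (0::complex))" for i j
  proof -
    have "(\<Sum>k\<in>UNIV. (if i = \<pi> k then 1 else 0) * cnj (if j = \<pi> k then 1 else 0)) =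
        (\<Sum>k\<in>UNIV. if k = inv_into UNIV \<pi> i then (if i = j then 1 else 0) else (0::complex))"
      using assms by (intro sum.cong) (auto simp: bij_inv_eq_iff[of \<pi> _ i] bij_is_inj surj_f_inv_f bij_is_surj)
    then show ?thesis by simp
  qed
  ultimately show ?thesis
    by (simp add: unitary_def conj_transpose_def perm_op_def matrix_matrix_mult_def mat_def vec_eq_iff)
qed

text \<open>Only words that agree with \<open>g\<close> off \<open>i\<close> and \<open>j\<close>
  contribute, and for distinct sites these are parametrized by their two letters there.\<close>

lemma on_sites_mult_vec_nth:
  assumes "i \<noteq> j"
  shows "(on_sites U i j *v \<psi>) $ g = (\<Sum>p\<in>UNIV. U $ (g i, g j) $ p * \<psi> $ g(i := fst p, j := snd p))"
proof -
  let ?F = "{f. \<forall>s. s \<noteq> i \<and> s \<noteq> j \<longrightarrow> g s = f s}"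
  have "(on_sites U i j *v \<psi>) $ g = (\<Sum>f\<in>?F. U $ (g i, g j) $ (f i, f j) * \<psi> $ f)"
    unfolding on_sites_def matrix_vector_mult_def vec_lambda_beta
    by (rule sum.mono_neutral_cong_right) auto
  also have "\<dots> = (\<Sum>p\<in>UNIV. U $ (g i, g j) $ p * \<psi> $ g(i := fst p, j := snd p))"
  proof -
    have "bij_betw (\<lambda>p. g(i := fst p, j := snd p)) UNIV ?F"
      using assms by (intro bij_betw_byWitness[where f' = "\<lambda>f. (f i, f j)"]) (auto simp: fun_eq_iff)
    from sum.reindex_bij_betw[OF this, of "\<lambda>f. U $ (g i, g j) $ (f i, f j) * \<psi> $ f"] assms
    show ?thesis by simp
  qed
  finally show ?thesis .
qed

text \<open>A gate changes only the tensor factor \<open>t\<close> on its own two sites and carries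
  the remaining factor \<open>r\<close> along.\<close>

lemma on_sites_mult_vec_factor:
  assumes "i \<noteq> j" and "\<And>f. \<psi> $ f = t $ (f i, f j) * r f" and "\<And>f a b. r (f(i := a, j := b)) = r f"
  shows "on_sites U i j *v \<psi> = (\<chi> f. (U *v t) $ (f i, f j) * r f)"
  using assms
  by (simp add: vec_eq_iff on_sites_mult_vec_nth) (simp add: matrix_vector_mult_def sum_distrib_right mult.assoc)

lemma inj_gate_map:
  assumes "i \<noteq> j" and "inj \<pi>"
  shows "inj (gate_map \<pi> i j)"
proof
  fix f g assume eq: "gate_map \<pi> i j f = gate_map \<pi> i j g"
  have "\<pi> (f i, f j) = \<pi> (g i, g j)"
    using fun_cong[OF eq, of i] fun_cong[OF eq, of j] assms(1) by (simp add: gate_map_def prod_eq_iff)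
  with assms(2) have "f i = g i" "f j = g j"
    by (auto dest: injD)
  then show "f = g"
    using fun_cong[OF eq] by (metis gate_map_def fun_upd_apply ext)
qed

lemma on_sites_perm_op_uniform_state:
  assumes "i \<noteq> j" and "bij \<pi>"
  shows "on_sites (perm_op \<pi>) i j *v uniform_state \<alpha> S = uniform_state \<alpha> (gate_map \<pi> i j ` S)"
proof -
  have "(on_sites (perm_op \<pi>) i j *v uniform_state \<alpha> S) $ g = uniform_state \<alpha> (gate_map \<pi> i j ` S) $ g" for g
  proof -
    \<comment> \<open>\<open>p\<close> holds the letters at the two sites before the gate, so
      \<open>f\<close> is the unique preimage of the word \<open>g\<close>.\<close>
    define p where "p = inv_into UNIV \<pi> (g i, g j)"
    define f where "f = g(i := fst p, j := snd p)"
    have p: "(g i, g j) = \<pi> q \<longleftrightarrow> q = p" for q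
      using assms(2) unfolding p_def by (metis bij_inv_eq_iff)
    have "gate_map \<pi> i j f = g"
      using assms(1) p[of p] by (auto simp: gate_map_def f_def fun_eq_iff) (metis fst_conv snd_conv)+
    then have "g \<in> gate_map \<pi> i j ` S \<longleftrightarrow> f \<in> S"
      using inj_image_mem_iff[OF inj_gate_map[OF assms(1) bij_is_inj[OF assms(2)]]] by metis
    moreover have "(on_sites (perm_op \<pi>) i j *v uniform_state \<alpha> S) $ g =
        (\<Sum>q\<in>UNIV. if q = p then (if f \<in> S then \<alpha> else 0) else 0)"
      unfolding on_sites_mult_vec_nth[OF assms(1)]
      by (intro sum.cong) (auto simp: perm_op_def p uniform_state_def f_def)
    ultimately show ?thesis
      by (simp add: uniform_state_def)
  qed
  then show ?thesis
    by (simp add: vec_eq_iff)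
qed

text \<open>Two words of \<open>S\<close> that agree on the complement of P coincide, which kills
  the off-diagonal entries. On the diagonal exactly one word of \<open>S\<close> extends a given
  assignment on P, so each entry is the squared modulus of the amplitude.\<close>

lemma absolutely_maximally_entangled_uniform_state:
  fixes S :: "('s::finite \<Rightarrow> 'd::finite) set"
  assumes even: "even CARD('s)"
    and card_S: "card S = CARD('d) ^ (CARD('s) div 2)"
    and \<alpha>: "cmod \<alpha> ^ 2 = 1 / card S"
    and mds: "\<And>P f g. \<lbrakk>card P = CARD('s) div 2; f \<in> S; g \<in> S; \<forall>i\<in>P. f i = g i\<rbrakk> \<Longrightarrow> f = g"
  shows "absolutely_maximally_entangled (uniform_state \<alpha> S)"
proof -
  have \<alpha>': "\<alpha> * cnj \<alpha> = 1 / card S"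
    by (simp only: complex_norm_square[symmetric] \<alpha>)
  have "(norm (uniform_state \<alpha> S))\<^sup>2 = (\<Sum>f\<in>UNIV. if f \<in> S then (cmod \<alpha>)\<^sup>2 else 0)"
    unfolding norm_vec_def L2_set_def
    by (subst real_sqrt_pow2) (auto simp: uniform_state_def sum_nonneg intro!: sum.cong)
  also have "\<dots> = card S * (cmod \<alpha>)\<^sup>2"
    by (subst sum.If_cases) simp_all
  also have "\<dots> = 1"
    unfolding \<alpha> using card_S by simp
  finally have norm: "norm (uniform_state \<alpha> S) = 1"
    by (metis norm_ge_zero one_power2 power2_eq_iff_nonneg zero_le_one)
  have "maximally_entangled (uniform_state \<alpha> S) P" if P: "card P = CARD('s) div 2" for P
    unfolding maximally_entangled_def
  proof (intro ballI)
    fix x y :: "'s \<Rightarrow> 'd" assume x: "x \<in> P \<rightarrow>\<^sub>E UNIV" and y: "y \<in> P \<rightarrow>\<^sub>E UNIV"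
    \<comment> \<open>Evenness gives the complement the same size as P, so its letters determine a
      word too.\<close>
    have cP: "card (- P) = CARD('s) div 2"
      using P even by (auto simp: Compl_eq_Diff_UNIV card_Diff_subset elim: evenE)
    show "reduced_density (uniform_state \<alpha> S) P x y = (if x = y then 1 / of_nat (CARD('d) ^ card P) else 0)"
    proof (cases "x = y")
      case False
      have "\<not> (override_on z x P \<in> S \<and> override_on z y P \<in> S)" for z
      proof
        assume "override_on z x P \<in> S \<and> override_on z y P \<in> S"
        then have "override_on z x P = override_on z y P"
          by (intro mds[OF cP]) auto
        then have "x s = y s" if "s \<in> P" for s
          using fun_cong that by (metis override_on_apply_in)
        with x y False show False
          by (meson PiE_ext)
      qed
      with False show ?thesis
        by (auto simp: reduced_density_def uniform_state_def intro!: sum.neutral)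
    next
      case True
      \<comment> \<open>Restriction to P is injective on \<open>S\<close>, and there are as many
        words as assignments on P, so every assignment is hit.\<close>
      have inj: "inj_on (\<lambda>f. restrict f P) S"
        by (intro inj_onI mds[OF P]) (metis restrict_apply')+
      have "(\<lambda>f. restrict f P) ` S = P \<rightarrow>\<^sub>E UNIV"
        using P card_S by (intro card_subset_eq) (auto simp: card_image[OF inj] card_PiE finite_PiE)
      with x obtain f where f: "f \<in> S" "x = restrict f P"
        by blast
      have "override_on z x P \<in> S \<longleftrightarrow> z = restrict f (- P)" if z: "z \<in> - P \<rightarrow>\<^sub>E UNIV" for z
      proof
        assume "override_on z x P \<in> S"
        then have "override_on z x P = f"
          using f by (intro mds[OF P]) auto
        then have "z s = f s" if "s \<in> - P" for s
          using that by (metis ComplD override_on_apply_notin)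
        with z show "z = restrict f (- P)"
          by (auto simp: fun_eq_iff PiE_def extensional_def)
      next
        assume "z = restrict f (- P)"
        then have "override_on z x P = f"
          by (auto simp: f fun_eq_iff override_on_def)
        with f show "override_on z x P \<in> S"
          by simp
      qed
      then have "reduced_density (uniform_state \<alpha> S) P x y =
          (\<Sum>z \<in> - P \<rightarrow>\<^sub>E UNIV. if z = restrict f (- P) then \<alpha> * cnj \<alpha> else 0)"
        unfolding reduced_density_def uniform_state_def using True by (intro sum.cong) auto
      also have "\<dots> = \<alpha> * cnj \<alpha>"
        by (simp add: finite_PiE)
      finally show ?thesis
        using True P card_S by (simp add: \<alpha>')
    qed
  qed
  with norm show ?thesis
    by (simp add: absolutely_maximally_entangled_def)
qed

section \<open>Bell pairs and their preparation from product states\<close>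

lemma UNIV_6: "(UNIV :: 6 set) = {1, 2, 3, 4, 5, 6}"
  by (rule card_subset_eq[symmetric]) auto

lemma prod_6: "(\<Prod>i\<in>UNIV. v i) = v 1 * v 2 * v 3 * v 4 * v 5 * v (6::6)"
  unfolding UNIV_6 by (simp add: mult.assoc)

lemma tensor_nth: "tensor v w $ (a, b) = v $ a * w $ b"
  by (simp add: tensor_def)

lemma bell_nth:
  fixes p :: "'d::finite \<times> 'd"
  shows "bell $ p = (if fst p = snd p then 1 / sqrt (real CARD('d)) else 0)"
proof -
  have "(\<Sum>a\<in>UNIV. tensor (axis a 1) (axis a 1)) $ p = (\<Sum>a\<in>UNIV. if a = fst p then (if fst p = snd p then 1 else 0) else (0 :: complex))"
    unfolding sum_component by (intro sum.cong) (auto simp: tensor_def axis_def)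
  then show ?thesis
    unfolding bell_def by (simp only: vector_scaleR_component) (simp add: scaleR_conv_of_real)
qed

definition bell_word :: "'d \<times> 'd \<times> 'd \<Rightarrow> 6 \<Rightarrow> 'd"
  where "bell_word = (\<lambda>(a, b, c) s. if s = 1 \<or> s = 4 then a else if s = 2 \<or> s = 5 then b else c)"

lemma bell_word_simps [simp]:
  "bell_word (a, b, c) 1 = a" "bell_word (a, b, c) 2 = b" "bell_word (a, b, c) 3 = c"
  "bell_word (a, b, c) 4 = a" "bell_word (a, b, c) 5 = b" "bell_word (a, b, c) 6 = c"
  by (simp_all add: bell_word_def)

lemma inj_bell_word: "inj bell_word"
proof (rule injI)
  fix t u :: "'a \<times> 'a \<times> 'a" assume "bell_word t = bell_word u"
  from fun_cong[OF this, of 1] fun_cong[OF this, of 2] fun_cong[OF this, of 3]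
  show "t = u" by (cases t; cases u) simp
qed

lemma bell_word_range: "f \<in> range bell_word \<longleftrightarrow> f 1 = f 4 \<and> f 2 = f 5 \<and> f 3 = f 6"
proof
  assume f: "f 1 = f 4 \<and> f 2 = f 5 \<and> f 3 = f 6"
  have "f s = bell_word (f 1, f 2, f 3) s" for s
  proof -
    have "s \<in> {1, 2, 3, 4, 5, 6}"
      unfolding UNIV_6[symmetric] by simp
    with f show ?thesis
      by (elim insertE emptyE) simp_all
  qed
  then show "f \<in> range bell_word" by blast
qed auto

lemma bell_pairs_eq_uniform_state:
  "(\<chi> f. bell $ (f 1, f 4) * bell $ (f 2, f 5) * bell $ (f 3, f 6)) =
    (uniform_state (1 / sqrt (real CARD('d)) ^ 3) (range bell_word) :: (6, 'd::finite) state)"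
  by (auto simp: vec_eq_iff bell_nth uniform_state_def bell_word_range power3_eq_cube simp flip: of_real_mult)

text \<open>The three copies of \<open>K\<close> act on disjoint pairs of sites, each still in the
  state \<open>tensor v v\<close>; coordinates of the other pairs are mere scalars.\<close>

lemma bell_pairs_from_product_state:
  fixes v :: "complex ^ 'd::finite"
  assumes K: "K *v tensor v v = bell"
  shows "on_sites K 1 4 *v (on_sites K 2 5 *v (on_sites K 3 6 *v tensor_all (\<lambda>_. v))) =
    (\<chi> f :: 6 \<Rightarrow> 'd. bell $ (f 1, f 4) * bell $ (f 2, f 5) * bell $ (f 3, f 6))"
proof -
  have "on_sites K 3 6 *v tensor_all (\<lambda>_. v) =
      (\<chi> f :: 6 \<Rightarrow> 'd. (K *v tensor v v) $ (f 3, f 6) * (v $ f 1 * v $ f 2 * v $ f 4 * v $ f 5))"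
    by (rule on_sites_mult_vec_factor) (simp_all add: tensor_all_def tensor_nth prod_6)
  moreover have "on_sites K 2 5 *v \<dots> =
      (\<chi> f :: 6 \<Rightarrow> 'd. (K *v tensor v v) $ (f 2, f 5) * (bell $ (f 3, f 6) * v $ f 1 * v $ f 4))"
    by (rule on_sites_mult_vec_factor) (simp_all add: tensor_nth K)
  moreover have "on_sites K 1 4 *v \<dots> =
      (\<chi> f :: 6 \<Rightarrow> 'd. (K *v tensor v v) $ (f 1, f 4) * (bell $ (f 2, f 5) * bell $ (f 3, f 6)))"
    by (rule on_sites_mult_vec_factor) (simp_all add: tensor_nth K)
  ultimately show ?thesis
    by (simp add: K mult.assoc)
qed

lemma norm_bell: "norm (bell :: 'd::finite two_site_state) = 1"
proof -
  have "(norm (bell :: 'd two_site_state))\<^sup>2 = (\<Sum>p\<in>UNIV. (cmod (bell $ (p :: 'd \<times> 'd)))\<^sup>2)"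
    by (simp add: norm_vec_def L2_set_def sum_nonneg)
  also have "\<dots> = (\<Sum>a\<in>UNIV. \<Sum>b\<in>UNIV. (cmod (bell $ (a :: 'd, b)))\<^sup>2)"
    by (simp add: sum.cartesian_product)
  also have "\<dots> = (\<Sum>a\<in>(UNIV :: 'd set). \<Sum>b\<in>UNIV. if a = b then 1 / real CARD('d) else 0)"
    by (intro sum.cong refl) (simp add: bell_nth norm_divide power_divide)
  also have "\<dots> = 1"
    by simp
  finally show ?thesis
    by (metis norm_ge_zero one_power2 power2_eq_iff_nonneg zero_le_one)
qed

text \<open>All coordinates of \<open>bell\<close> are real, so a real orthogonal map moves a basis
  vector to it, and its matrix is unitary over the complex numbers. This supplies the gate
  \<open>K\<close> for the preparation from a product state.\<close>

lemma ex_unitary_to_bell: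
  "\<exists>K. unitary K \<and> K *v tensor (axis a 1) (axis a 1) = (bell :: 'd::finite two_site_state)"
proof -
  define b :: "real ^ ('d \<times> 'd)" where "b = (\<chi> p. Re (bell $ p))"
  have b: "complex_of_real (b $ p) = bell $ p" for p
    by (simp add: b_def bell_nth)
  have "norm b = norm (bell :: 'd two_site_state)"
    by (simp add: norm_vec_def L2_set_def b[symmetric])
  then have "norm (axis (a, a) 1 :: real ^ ('d \<times> 'd)) = norm b"
    by (simp add: norm_bell norm_axis_1)
  then obtain T :: "real ^ ('d \<times> 'd) \<Rightarrow> real ^ ('d \<times> 'd)" where T: "orthogonal_transformation T" "T (axis (a, a) 1) = b"
    using orthogonal_transformation_exists by blast
  define M where "M = matrix T"
  have M: "transpose M ** M = mat 1" "M ** transpose M = mat 1"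
    using T(1) by (simp_all add: M_def orthogonal_transformation_matrix orthogonal_matrix_def)
  have col: "M $ p $ (a, a) = b $ p" for p
    by (simp add: M_def matrix_def T(2))
  define K :: "'d two_site_op" where "K = (\<chi> i j. complex_of_real (M $ i $ j))"
  have "unitary K"
    using M by (simp add: unitary_def K_def conj_transpose_def matrix_matrix_mult_def mat_def vec_eq_iff transpose_def
      flip: of_real_mult of_real_sum)
  moreover have "tensor (axis a 1) (axis a 1) = (axis (a, a) 1 :: 'd two_site_state)"
    by (auto simp: tensor_def axis_def vec_eq_iff)
  moreover have "(\<Sum>q\<in>UNIV. K $ p $ q * axis (a, a) 1 $ q) = bell $ p" for p
  proof -
    have "(\<Sum>q\<in>UNIV. K $ p $ q * axis (a, a) 1 $ q) = (\<Sum>q\<in>UNIV. if q = (a, a) then bell $ p else 0)"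
      by (intro sum.cong) (auto simp: axis_def K_def col b)
    then show ?thesis by simp
  qed
  then have "K *v axis (a, a) 1 = bell"
    by (simp add: matrix_vector_mult_def vec_eq_iff)
  ultimately show ?thesis 
    by (intro exI[of _ K]) simp
qed

section \<open>Linear gates\<close>

text \<open>The matrix with rows (a, b) and (c, d), transported along \<open>h\<close> from field
  elements to basis labels.\<close>

definition lin_gate :: "('d \<Rightarrow> 'k::field) \<Rightarrow> 'k \<Rightarrow> 'k \<Rightarrow> 'k \<Rightarrow> 'k \<Rightarrow> 'd \<times> 'd \<Rightarrow> 'd \<times> 'd"
  where "lin_gate h a b c d = (\<lambda>(p, q). (inv_into UNIV h (a * h p + b * h q), inv_into UNIV h (c * h p + d * h q)))"

lemma solve_2x2:
  fixes a b c d :: "'k::field"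
  assumes "a * d - b * c \<noteq> 0" and "a * x + b * y = a * x' + b * y'" and "c * x + d * y = c * x' + d * y'"
  shows "x = x' \<and> y = y'"
proof -
  have "(a * d - b * c) * (x - x') =
      d * ((a * x + b * y) - (a * x' + b * y')) - b * ((c * x + d * y) - (c * x' + d * y'))"
    by (simp add: algebra_simps)
  moreover have "(a * d - b * c) * (y - y') =
      a * ((c * x + d * y) - (c * x' + d * y')) - c * ((a * x + b * y) - (a * x' + b * y'))"
    by (simp add: algebra_simps)
  ultimately show ?thesis
    using assms(1) unfolding assms(2,3) by simp
qed

lemma h_lin_gate:
  assumes "bij h"
  shows "h (fst (lin_gate h a b c d (p, q))) = a * h p + b * h q"
    and "h (snd (lin_gate h a b c d (p, q))) = c * h p + d * h q"
  using assms by (simp_all add: lin_gate_def bij_is_surj surj_f_inv_f)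

lemma bij_lin_gate:
  fixes h :: "'d::finite \<Rightarrow> 'k::field"
  assumes h: "bij h" and "a * d - b * c \<noteq> 0"
  shows "bij (lin_gate h a b c d)"
proof -
  have "inj (lin_gate h a b c d)"
  proof (rule injI, clarify)
    fix p q p' q' assume eq: "lin_gate h a b c d (p, q) = lin_gate h a b c d (p', q')"
    have "h p = h p' \<and> h q = h q'"
      using arg_cong[OF eq, of "\<lambda>r. h (fst r)"] arg_cong[OF eq, of "\<lambda>r. h (snd r)"]
      by (intro solve_2x2[OF assms(2)]) (simp_all only: h_lin_gate[OF h])
    with h show "p = p' \<and> q = q'"
      by (simp add: bij_is_inj inj_eq)
  qed
  then show ?thesis
    by (simp add: bij_def finite_UNIV_inj_surj)
qed

text \<open>Inputs together with outputs form a linear code of length 4 and dimension 2. Any two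
  letters determine a word because every entry and the determinant are nonzero.\<close>

lemma perfect_tensor_lin_gate:
  fixes h :: "'d::finite \<Rightarrow> 'k::field"
  assumes h: "bij h" and det: "a * d - b * c \<noteq> 0" and nz: "a \<noteq> 0" "b \<noteq> 0" "c \<noteq> 0" "d \<noteq> 0"
  shows "perfect_tensor (perm_op (lin_gate h a b c d))"
proof -
  let ?\<pi> = "lin_gate h a b c d"
  define S :: "(4 \<Rightarrow> 'd) set" where "S = {f. (f 3, f 4) = ?\<pi> (f 1, f 2)}"
  have S: "h (f 3) = a * h (f 1) + b * h (f 2)" "h (f 4) = c * h (f 1) + d * h (f 2)" if "f \<in> S" for f
  proof -
    have "f 3 = fst (?\<pi> (f 1, f 2))" "f 4 = snd (?\<pi> (f 1, f 2))"
      using that by (simp_all add: S_def prod_eq_iff)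
    then show "h (f 3) = a * h (f 1) + b * h (f 2)" "h (f 4) = c * h (f 1) + d * h (f 2)"
      by (simp_all only: h_lin_gate[OF h])
  qed
  have word_eqI: "f = g" if "f \<in> S" "g \<in> S" "f 1 = g 1" "f 2 = g 2" for f g
  proof
    fix s :: 4
    have "(f 3, f 4) = (g 3, g 4)"
      using that unfolding S_def mem_Collect_eq by (simp only:)
    moreover have "s \<in> {1, 2, 3, 4}"
      unfolding UNIV_4[symmetric] by simp
    ultimately show "f s = g s"
      using that by (elim insertE emptyE) simp_all
  qed
  have "bij_betw (\<lambda>f. (f 1, f 2)) S (UNIV :: ('d \<times> 'd) set)"
  proof (rule bij_betwI')
    fix p :: "'d \<times> 'd"
    define f :: "4 \<Rightarrow> 'd" where
      "f = (\<lambda>s. if s = 1 then fst p else if s = 2 then snd p else if s = 3 then fst (?\<pi> p) else snd (?\<pi> p))"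
    have "f \<in> S" "p = (f 1, f 2)"
      by (simp_all add: f_def S_def)
    then show "\<exists>f\<in>S. p = (f 1, f 2)" by blast
  qed (auto intro: word_eqI)
  then have card_S: "card S = CARD('d) ^ 2"
    by (simp add: bij_betw_same_card power2_eq_square)
  have "f = g" if P: "card P = 2" and f: "f \<in> S" and g: "g \<in> S" and eq: "\<forall>i\<in>P. f i = g i" for P f g
  proof -
    \<comment> \<open>The difference of two words satisfies the same linear equations, so it
      suffices that two zeros force it to vanish.\<close>
    define x where "x s = h (f s) - h (g s)" for s
    have x3: "x 3 = a * x 1 + b * x 2" and x4: "x 4 = c * x 1 + d * x 2"
      using S[OF f] S[OF g] by (simp_all add: x_def algebra_simps)
    obtain i j where P_eq: "P = {i, j}" and "i \<noteq> j"
      using P by (meson card_2_iff)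
    have x: "x i = 0" "x j = 0"
      using eq by (auto simp: P_eq x_def)
    have "i \<in> {1, 2, 3, 4}" "j \<in> {1, 2, 3, 4}"
      unfolding UNIV_4[symmetric] by simp_all
    \<comment> \<open>Two zero inputs are immediate; a zero input and a zero output leave a nonzero
      entry times the other input; two zero outputs call for the determinant.\<close>
    then have "x 1 = 0 \<and> x 2 = 0"
      using x \<open>i \<noteq> j\<close> x3 x4 nz solve_2x2[OF det, of "x 1" "x 2" 0 0]
      by (elim insertE emptyE) simp_all
    then show "f = g"
      using f g h by (intro word_eqI) (auto simp: x_def bij_is_inj inj_eq)
  qed
  then have "absolutely_maximally_entangled (uniform_state (1 / of_nat CARD('d)) S)"
    by (intro absolutely_maximally_entangled_uniform_state)
      (simp_all add: card_S norm_divide power_divide)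
  moreover have "(\<chi> f. perm_op ?\<pi> $ (f 3, f 4) $ (f 1, f 2) / of_nat CARD('d)) =
      (uniform_state (1 / of_nat CARD('d)) S :: (4, 'd) state)"
    by (simp add: vec_eq_iff perm_op_def uniform_state_def S_def)
  ultimately show ?thesis
    by (simp add: perfect_tensor_def)
qed

section \<open>The interpolation code and its nodes\<close>

text \<open>Applied to the difference of two words, this says that any three letters determine a
  word. A zero at site 1 lowers the degree of N and so acts as a root at infinity.\<close>

lemma interpolation_code_mds:
  fixes x y1 y2 y3 :: "'k::field" and c :: "6 \<Rightarrow> 'k"
  assumes dist: "distinct [0, x, y1, y2, y3]" and l: "l \<noteq> 0"
    and c1: "c 1 = c 4 + c 5 + c 6"
    and c2: "c 2 = l * (y2 * y3 * c 4 + y1 * y3 * c 5 + y1 * y2 * c 6)"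
    and c3: "c 3 = l * ((x - y2) * (x - y3) * c 4 + (x - y1) * (x - y3) * c 5 + (x - y1) * (x - y2) * c 6)"
    and P: "card P = 3" "\<forall>s\<in>P. c s = 0"
  shows "c = (\<lambda>_. 0)"
proof -
  \<comment> \<open>The expansion of
    \<open>c 4 (X-y2)(X-y3) + c 5 (X-y1)(X-y3) + c 6 (X-y1)(X-y2)\<close>, whose leading coefficient
    is \<open>c 1\<close>.\<close>
  define N where "N = [:y2 * y3 * c 4 + y1 * y3 * c 5 + y1 * y2 * c 6,
      - ((y2 + y3) * c 4 + (y1 + y3) * c 5 + (y1 + y2) * c 6), c 1:]"
  \<comment> \<open>Site 1 stands for infinity and is kept out of every use of \<open>pt\<close>;
    the last branch is meant for site 6.\<close>
  define pt :: "6 \<Rightarrow> 'k" where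
    "pt s = (if s = 2 then 0 else if s = 3 then x else if s = 4 then y1 else if s = 5 then y2 else y3)" for s
  have N: "poly N 0 = y2 * y3 * c 4 + y1 * y3 * c 5 + y1 * y2 * c 6"
    "poly N x = (x - y2) * (x - y3) * c 4 + (x - y1) * (x - y3) * c 5 + (x - y1) * (x - y2) * c 6"
    "poly N y1 = c 4 * ((y1 - y2) * (y1 - y3))"
    "poly N y2 = c 5 * ((y2 - y1) * (y2 - y3))"
    "poly N y3 = c 6 * ((y3 - y1) * (y3 - y2))"
    by (simp_all add: N_def c1 algebra_simps)
  have six: "s \<in> {1, 2, 3, 4, 5, 6}" for s :: 6
    unfolding UNIV_6[symmetric] by simp
  have root: "poly N (pt s) = 0" if "s \<noteq> 1" "c s = 0" for s
    using six[of s] that l c2 c3 by (elim insertE emptyE) (auto simp: pt_def N)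
  have inj: "inj_on pt (- {1})"
  proof (rule inj_onI)
    fix s t assume "s \<in> - {1}" "t \<in> - {1}" "pt s = pt t"
    with six[of s] six[of t] dist show "s = t"
      by (elim insertE emptyE) (simp_all add: pt_def)
  qed
  have "N = 0"
  proof (rule ccontr)
    assume "N \<noteq> 0"
    have "card (pt ` (P - {1})) \<le> card {z. poly N z = 0}"
      using P(2) root \<open>N \<noteq> 0\<close> by (intro card_mono poly_roots_finite) auto
    moreover have "card (pt ` (P - {1})) = card (P - {1})"
      by (intro card_image inj_on_subset[OF inj]) auto
    moreover have "card {z. poly N z = 0} \<le> Polynomial.degree N"
      using \<open>N \<noteq> 0\<close> by (rule card_poly_roots_bound)
    \<comment> \<open>If P contains site 1, only two roots remain but the degree is at most 1.
      Either way there is one root too many.\<close>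
    moreover have "Polynomial.degree N \<le> (if 1 \<in> P then 1 else 2)"
      using P(2) by (auto simp: N_def intro!: degree_le simp: coeff_pCons split: nat.split)
    ultimately show False
      using P(1) by (auto split: if_splits)
  qed
  \<comment> \<open>The values of N at y1, y2, y3 are nonzero multiples of \<open>c 4\<close>,
    \<open>c 5\<close>, \<open>c 6\<close>.\<close>
  then have "c 1 = 0" "c 4 = 0" "c 5 = 0" "c 6 = 0"
    using N dist by (auto simp: N_def)
  then have "c s = 0" for s
    using six[of s] c2 c3 by (elim insertE emptyE) simp_all
  then show ?thesis by blast
qed

lemma ex_interpolation_nodes:
  assumes "CARD('k::{field,finite}) \<ge> 5"
  obtains x y1 y2 y3 :: "'k::{field,finite}" where "distinct [0, x, y1, y2, y3]"
    and "y1 * y2 + y3 * x - y3 * (y1 + y2) \<noteq> 0"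
proof -
  have "4 \<le> card (UNIV - {0 :: 'k})"
    using assms by (simp add: card_Diff_singleton)
  then obtain T where "T \<subseteq> UNIV - {0 :: 'k}" "card T = 4"
    using obtain_subset_with_card_n by metis
  moreover obtain xs where "set xs = T" "distinct xs"
    using finite_distinct_list[of T] by auto
  ultimately have "length xs = 4" "0 \<notin> set xs"
    by (auto simp flip: distinct_card)
  moreover from this(1) obtain p q r s where "xs = [p, q, r, s]"
    by (auto simp: numeral_eq_Suc length_Suc_conv)
  ultimately have pqrs: "distinct [0, p, q, r, s]"
    using \<open>distinct xs\<close> by simp
  \<comment> \<open>The sums \<open>p + q\<close> and \<open>p + r\<close> cannot both vanish, since
    q and r differ.\<close>
  obtain y1 y2 u v :: 'k where uv: "distinct [0, y1, y2, u, v]" and "y1 + y2 \<noteq> 0"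
  proof (cases "p + q = 0")
    case True
    with pqrs have "p + r \<noteq> 0"
      by (auto simp: add_eq_0_iff)
    with pqrs show thesis
      by (intro that[of p r q s]) auto
  next
    case False
    with pqrs show thesis
      by (intro that[of p q r s]) auto
  qed
  \<comment> \<open>The two cases are the two ways of using \<open>u\<close> and \<open>v\<close> as
    \<open>x\<close> and \<open>y3\<close>.\<close>
  consider "y1 * y2 + v * u - v * (y1 + y2) \<noteq> 0" | "y1 * y2 + u * v - u * (y1 + y2) \<noteq> 0"
  proof -
    have "(y1 * y2 + v * u - v * (y1 + y2)) - (y1 * y2 + u * v - u * (y1 + y2)) = (u - v) * (y1 + y2)"
      by (simp add: algebra_simps)
    then show thesis
      using that uv \<open>y1 + y2 \<noteq> 0\<close> by fastforce
  qed
  then show thesis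
    using uv by cases (auto intro: that[of u y1 y2 v] that[of v y1 y2 u])
qed

text \<open>
  The entries of the gates are obtained by factorising the \<open>3 \<times> 3\<close> matrix with rows \<open>(1, 1, 1)\<close>,
  \<open>l (y2 y3, y1 y3, y1 y2)\<close> and \<open>l ((x-y2)(x-y3), (x-y1)(x-y3), (x-y1)(x-y2))\<close>.
\<close>

lemma gate_map_word:
  fixes h :: "'d \<Rightarrow> 'k::field" and x y1 y2 y3 :: 'k
  defines "l \<equiv> y1 * y2 + y3 * x - y3 * (y1 + y2)"
  defines "A \<equiv> lin_gate h 1 1 (y2 * (x - y2) * (y3 - y1)) (y1 * (x - y1) * (y3 - y2))"
    and "B \<equiv> lin_gate h 1 1 (y3 * (x - y3)) l"
    and "C \<equiv> lin_gate h y3 (y1 * y2) (y3 - x) ((x - y1) * (x - y2))"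
  assumes h: "bij h" and f: "f = gate_map C 2 3 (gate_map B 1 3 (gate_map A 1 2 (bell_word t)))"
  shows "h (f 1) = h (f 4) + h (f 5) + h (f 6)"
    and "h (f 2) = l * (y2 * y3 * h (f 4) + y1 * y3 * h (f 5) + y1 * y2 * h (f 6))"
    and "h (f 3) = l * ((x - y2) * (x - y3) * h (f 4) + (x - y1) * (x - y3) * h (f 5) + (x - y1) * (x - y2) * h (f 6))"
proof -
  obtain a b c where t: "t = (a, b, c)" by (cases t)
  show "h (f 1) = h (f 4) + h (f 5) + h (f 6)"
    "h (f 2) = l * (y2 * y3 * h (f 4) + y1 * y3 * h (f 5) + y1 * y2 * h (f 6))"
    "h (f 3) = l * ((x - y2) * (x - y3) * h (f 4) + (x - y1) * (x - y3) * h (f 5) + (x - y1) * (x - y2) * h (f 6))"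
    by (simp_all add: f gate_map_def t A_def B_def C_def h_lin_gate[OF h]) (simp_all add: l_def algebra_simps)
qed

text \<open>The factors \<open>1 *\<close> match the determinants \<open>a * d - b * c\<close> in the lemmas on \<open>lin_gate\<close>.\<close>

lemma gate_determinants_nonzero:
  fixes x y1 y2 y3 :: "'k::field"
  defines "l \<equiv> y1 * y2 + y3 * x - y3 * (y1 + y2)"
  assumes dist: "distinct [0, x, y1, y2, y3]" and l: "l \<noteq> 0"
  shows "1 * (y1 * (x - y1) * (y3 - y2)) - 1 * (y2 * (x - y2) * (y3 - y1)) \<noteq> 0"
    and "1 * l - 1 * (y3 * (x - y3)) \<noteq> 0"
    and "y3 * ((x - y1) * (x - y2)) - y1 * y2 * (y3 - x) \<noteq> 0"
proof -
  have "1 * (y1 * (x - y1) * (y3 - y2)) - 1 * (y2 * (x - y2) * (y3 - y1)) = (y1 - y2) * l"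
    "1 * l - 1 * (y3 * (x - y3)) = (y3 - y1) * (y3 - y2)"
    "y3 * ((x - y1) * (x - y2)) - y1 * y2 * (y3 - x) = x * l"
    by (simp_all add: l_def algebra_simps)
  then show "1 * (y1 * (x - y1) * (y3 - y2)) - 1 * (y2 * (x - y2) * (y3 - y1)) \<noteq> 0"
    and "1 * l - 1 * (y3 * (x - y3)) \<noteq> 0"
    and "y3 * ((x - y1) * (x - y2)) - y1 * y2 * (y3 - x) \<noteq> 0"
    using dist l by (simp_all only: mult_eq_0_iff right_minus_eq) auto
qed

text \<open>The gates act injectively on the support of the Bell pairs, so the final code has D^3
  words, and its linear relations are those of the interpolation code.\<close>

lemma absolutely_maximally_entangled_lin_gates:
  fixes h :: "'d::finite \<Rightarrow> 'k::field" and x y1 y2 y3 :: 'k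
  defines "l \<equiv> y1 * y2 + y3 * x - y3 * (y1 + y2)"
  defines "A \<equiv> lin_gate h 1 1 (y2 * (x - y2) * (y3 - y1)) (y1 * (x - y1) * (y3 - y2))"
    and "B \<equiv> lin_gate h 1 1 (y3 * (x - y3)) l"
    and "C \<equiv> lin_gate h y3 (y1 * y2) (y3 - x) ((x - y1) * (x - y2))"
  assumes h: "bij h" and dist: "distinct [0, x, y1, y2, y3]" and l: "l \<noteq> 0"
    and bij: "bij A" "bij B" "bij C"
  shows "absolutely_maximally_entangled
    (on_sites (perm_op C) 2 3 *v (on_sites (perm_op B) 1 3 *v (on_sites (perm_op A) 1 2 *v
      (\<chi> f :: 6 \<Rightarrow> 'd. bell $ (f 1, f 4) * bell $ (f 2, f 5) * bell $ (f 3, f 6)))))"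
proof -
  define \<Phi> where "\<Phi> = gate_map C (2 :: 6) 3 \<circ> gate_map B 1 3 \<circ> gate_map A 1 2 \<circ> bell_word"
  have "inj \<Phi>"
    unfolding \<Phi>_def by (intro inj_compose inj_gate_map inj_bell_word bij_is_inj bij) simp_all
  then have card: "card (range \<Phi>) = CARD('d) ^ 3"
    by (simp add: card_image power3_eq_cube)
  have mds: "f = g" if P: "card P = 3" and f: "f \<in> range \<Phi>" and g: "g \<in> range \<Phi>" and eq: "\<forall>s\<in>P. f s = g s" for P f g
  proof -
    obtain t u where t: "f = \<Phi> t" and u: "g = \<Phi> u"
      using f g by blast
    note F = gate_map_word[OF h t[unfolded \<Phi>_def comp_apply A_def B_def C_def l_def]]
    note G = gate_map_word[OF h u[unfolded \<Phi>_def comp_apply A_def B_def C_def l_def]]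
    have "(\<lambda>s. h (f s) - h (g s)) = (\<lambda>_. 0)"
      by (rule interpolation_code_mds[OF dist l _ _ _ P])
        (simp_all add: F(1,2,3) G(1,2,3) eq l_def, simp_all add: algebra_simps)
    then have "h (f s) = h (g s)" for s
      by (metis eq_iff_diff_eq_0)
    with h have "f s = g s" for s
      by (simp add: bij_is_inj inj_eq)
    then show ?thesis by blast
  qed
  have "absolutely_maximally_entangled (uniform_state (1 / sqrt (real CARD('d)) ^ 3) (range \<Phi>))"
  proof (rule absolutely_maximally_entangled_uniform_state)
    have "(sqrt (real CARD('d)) ^ 3)\<^sup>2 = ((sqrt (real CARD('d)))\<^sup>2) ^ 3"
      by (simp only: power_mult[symmetric] mult.commute)
    then show "(cmod (1 / sqrt (real CARD('d)) ^ 3))\<^sup>2 = 1 / card (range \<Phi>)"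
      by (simp add: card norm_divide norm_power power_divide)
  qed (use mds in \<open>simp_all add: card\<close>)
  moreover have "range \<Phi> = gate_map C 2 3 ` gate_map B 1 3 ` gate_map A 1 2 ` range bell_word"
    by (simp add: \<Phi>_def image_comp)
  ultimately show ?thesis
    by (simp add: bell_pairs_eq_uniform_state on_sites_perm_op_uniform_state bij)
qed

theorem mainTheorem5:
  assumes "primepow CARD('d::finite)" and "CARD('d) \<ge> 5"
  shows "(\<exists>A B C :: 'd two_site_op.
      unitary A \<and> unitary B \<and> unitary C \<and>
      perfect_tensor A \<and> perfect_tensor B \<and> perfect_tensor C \<and>
      (\<forall>(v :: complex ^ 'd) (K :: 'd two_site_op).
        norm v = 1 \<and> unitary K \<and> K *v tensor v v = bell \<longrightarrow>
        absolutely_maximally_entangled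
          ((on_sites C 2 3 ** on_sites B 1 3 ** on_sites A 1 2 **
            on_sites K 1 4 ** on_sites K 2 5 ** on_sites K 3 6)
             *v tensor_all (\<lambda>_. v) :: (6, 'd) state)))
    \<and> (\<exists>\<psi> :: (6, 'd) state. absolutely_maximally_entangled \<psi> \<and>
        (\<exists>\<beta>. three_bell_pairs \<beta> \<and> created_from 3 \<beta> \<psi>) \<and>
        (\<exists>\<phi>. product_state \<phi> \<and> created_from 6 \<phi> \<psi>))"
proof -
  have "\<exists>h :: 'd \<Rightarrow> 'd gf. bij_betw h UNIV UNIV"
    by (rule finite_same_card_bij) (simp_all add: CARD_gf assms)
  then obtain h :: "'d \<Rightarrow> 'd gf" where h: "bij h"
    by blast
  obtain x y1 y2 y3 :: "'d gf" where dist: "distinct [0, x, y1, y2, y3]"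
    and l: "y1 * y2 + y3 * x - y3 * (y1 + y2) \<noteq> 0" (is "?l \<noteq> 0")
    using ex_interpolation_nodes[where 'k="'d gf"] assms by (metis CARD_gf)
  define \<pi>A where "\<pi>A = lin_gate h 1 1 (y2 * (x - y2) * (y3 - y1)) (y1 * (x - y1) * (y3 - y2))"
  define \<pi>B where "\<pi>B = lin_gate h 1 1 (y3 * (x - y3)) ?l"
  define \<pi>C where "\<pi>C = lin_gate h y3 (y1 * y2) (y3 - x) ((x - y1) * (x - y2))"
  note det_nz = gate_determinants_nonzero[OF dist l]
  have bij: "bij \<pi>A" "bij \<pi>B" "bij \<pi>C"
    unfolding \<pi>A_def \<pi>B_def \<pi>C_def by (rule bij_lin_gate[OF h], rule det_nz)+
  \<comment> \<open>Every entry is 1, a product of differences of the nodes 0, x, y1, y2, y3 up to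
    sign, or \<open>?l\<close>.\<close>
  have perfect: "perfect_tensor (perm_op \<pi>A)" "perfect_tensor (perm_op \<pi>B)" "perfect_tensor (perm_op \<pi>C)"
    unfolding \<pi>A_def \<pi>B_def \<pi>C_def
    by (rule perfect_tensor_lin_gate[OF h], rule det_nz, use dist l in auto)+
  define \<beta> where "\<beta> = (\<chi> f :: 6 \<Rightarrow> 'd. bell $ (f 1, f 4) * bell $ (f 2, f 5) * bell $ (f 3, f 6))"
  define \<psi> where "\<psi> = on_sites (perm_op \<pi>C) 2 3 *v (on_sites (perm_op \<pi>B) 1 3 *v (on_sites (perm_op \<pi>A) 1 2 *v \<beta>))"
  have ame: "absolutely_maximally_entangled \<psi>"
    unfolding \<psi>_def \<beta>_def \<pi>A_def \<pi>B_def \<pi>C_def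
    by (rule absolutely_maximally_entangled_lin_gates[OF h dist l bij[unfolded \<pi>A_def \<pi>B_def \<pi>C_def]])
  \<comment> \<open>The copies of \<open>K\<close> always produce the same three Bell pairs, so the
    final state depends neither on \<open>K\<close> nor on \<open>v\<close>.\<close>
  have \<psi>: "(on_sites (perm_op \<pi>C) 2 3 ** on_sites (perm_op \<pi>B) 1 3 ** on_sites (perm_op \<pi>A) 1 2 **
      on_sites K 1 4 ** on_sites K 2 5 ** on_sites K 3 6) *v tensor_all (\<lambda>_. v) = \<psi>"
    if "K *v tensor v v = bell" for K v
    by (simp only: matrix_vector_mul_assoc[symmetric] bell_pairs_from_product_state[OF that] \<psi>_def \<beta>_def)
  have "three_bell_pairs \<beta>"
    unfolding three_bell_pairs_def \<beta>_def
    by (rule exI[of _ 1], rule exI[of _ 4], rule exI[of _ 2], rule exI[of _ 5], rule exI[of _ 3], rule exI[of _ 6]) simp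
  moreover have "created_from 3 \<beta> \<psi>"
    unfolding created_from_def
    \<comment> \<open>\<open>fold\<close> applies the head of the list first, so the gates appear in
      order of time, opposite to the operator product.\<close>
    by (rule exI[of _ "[(perm_op \<pi>A, 1, 2), (perm_op \<pi>B, 1, 3), (perm_op \<pi>C, 2, 3)]"])
      (simp add: unitary_perm_op bij \<psi>_def)
  \<comment> \<open>The label \<open>undefined\<close> is an arbitrary choice of basis vector for
    the product state.\<close>
  moreover obtain K :: "'d two_site_op" where K: "unitary K" "K *v tensor (axis undefined 1) (axis undefined 1) = bell"
    using ex_unitary_to_bell by blast
  have "created_from 6 (tensor_all (\<lambda>_. axis undefined 1)) \<psi>"
    unfolding created_from_def
    by (rule exI[of _ "[(K, 3, 6), (K, 2, 5), (K, 1, 4), (perm_op \<pi>A, 1, 2), (perm_op \<pi>B, 1, 3), (perm_op \<pi>C, 2, 3)]"])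
      (simp add: unitary_perm_op bij K(1) bell_pairs_from_product_state[OF K(2)] \<psi>_def \<beta>_def)
  moreover have "product_state (tensor_all (\<lambda>_ :: 6. axis (undefined :: 'd) 1))"
    unfolding product_state_def by (rule exI[of _ "\<lambda>_. axis undefined 1"]) (simp add: norm_axis_1)
  ultimately have created: "\<exists>\<psi> :: (6, 'd) state. absolutely_maximally_entangled \<psi> \<and>
      (\<exists>\<beta>. three_bell_pairs \<beta> \<and> created_from 3 \<beta> \<psi>) \<and>
      (\<exists>\<phi>. product_state \<phi> \<and> created_from 6 \<phi> \<psi>)"
    using ame by blast
  show ?thesis
    by (rule conjI[OF _ created], rule exI[of _ "perm_op \<pi>A"], rule exI[of _ "perm_op \<pi>B"],
        rule exI[of _ "perm_op \<pi>C"])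
      (simp add: unitary_perm_op bij perfect \<psi> ame)
qed

end
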